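(* Let $R$ be a commutative ring with $1\neq 0$ and let $R[x_1,\dots,x_n]$ be the polynomial ring over $R$ in $n\geq 1$ indeterminates. Then $\widetilde{\Gamma}(R[x_1,\dots,x_n])$ is complete if and only if $R$ is (up to isomorphism) a subring of a product of two integral domains or $R$ satisfies one of the following (equivalent) statements: (a) $Z(R[x])$ is an ideal of $R[x]$, where $x$ is an indeterminate; (b) $R$ satisfies property A and $Z(R)$ is an ideal of $R$; (c) if $I$ is an ideal of $R$ generated by a finite number of zero-divisors, then $\mathrm{ann}_R(I)\neq (0)$.
   Context: For a commutative ring $A$ with $1\neq 0$, $Z(A)$ denotes the set of zero-divisors of $A$ (including $0$) and $Z(A)^{\star}=Z(A)\setminus\{0\}$. $\widetilde{\Gamma}(A)$ is the undirected simple graph with vertex set $Z(A)^{\star}$ in which distinct vertices $x,y$ are adjacent if and only if $xy=0$ or $x+y\in Z(A)$. A graph is complete if any two distinct vertices are adjacent; a graph with $0$ or $1$ vertices is regarded as complete. A ring $R$ satisfies property A if each finitely generated ideal $I\subset Z(R)$ has nonzero annihilator. $\mathrm{ann}_R(I)=\{r\in R : rI=(0)\}$. *)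

theory Defs
  imports
    "HOL-Algebra.Algebraic_Closure_Type"
    "HOL-Algebra.Chinese_Remainder"
    "HOL-Library.Poly_Mapping"
begin

text \<open>
  Rings are types of class \<^class>\<open>comm_ring_1\<close> (which contains \<open>1 \<noteq> 0\<close>), and
  \<^const>\<open>ring_of_type_algebra\<close> is the ring on all of such a type, as an object of HOL-Algebra.
\<close>

text \<open>
  Polynomials as finitely supported functions on exponent vectors; the product of
  \<^type>\<open>poly_mapping\<close> is convolution. For a finite type \<open>'v\<close> this is the polynomial ring in
  \<open>n = CARD('v) \<ge> 1\<close> indeterminates, and every \<open>n \<ge> 1\<close> is the cardinality of some type.
\<close>

type_synonym ('a, 'v) mv_poly = "('v \<Rightarrow>\<^sub>0 nat) \<Rightarrow>\<^sub>0 'a"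

definition zero_divisors :: "'a::comm_ring_1 set" where
  "zero_divisors = {a. \<exists>b. b \<noteq> 0 \<and> a * b = 0}"

definition annihilator :: "'a::comm_ring_1 set \<Rightarrow> 'a set" where
  "annihilator I = {r. \<forall>i\<in>I. r * i = 0}"

definition fin_gen_ideal :: "'a::comm_ring_1 set \<Rightarrow> bool" where
  "fin_gen_ideal I \<longleftrightarrow> (\<exists>S. finite S \<and> I = Idl\<^bsub>ring_of_type_algebra\<^esub> S)"

definition property_A :: "'a::comm_ring_1 itself \<Rightarrow> bool" where
  "property_A _ \<longleftrightarrow>
     (\<forall>I :: 'a set. fin_gen_ideal I \<and> I \<subseteq> zero_divisors \<longrightarrow> annihilator I \<noteq> {0})"

text \<open>A simple graph is a vertex set with a set of two-element edges.\<close>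

type_synonym 'v sgraph = "'v set \<times> 'v set set"

definition complete_sgraph :: "'v sgraph \<Rightarrow> bool" where
  "complete_sgraph G \<longleftrightarrow> (\<forall>x\<in>fst G. \<forall>y\<in>fst G. x \<noteq> y \<longrightarrow> {x, y} \<in> snd G)"

definition zd_graph :: "'a::comm_ring_1 sgraph" where
  "zd_graph =
     (zero_divisors - {0},
      {{x, y} | x y. x \<in> zero_divisors - {0} \<and> y \<in> zero_divisors - {0} \<and> x \<noteq> y \<and>
                     (x * y = 0 \<or> x + y \<in> zero_divisors)})"

text \<open>
  The two domains have to be sought in a fixed type. The type \<open>'a set\<close> is no restriction:
  by the lemma \<open>subring_of_domain_product_any_type\<close> below, domains living in arbitrary
  types can be replaced by domains of cosets of the ring.
\<close>

definition subring_of_domain_product :: "('a, 'm) ring_scheme \<Rightarrow> bool" where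
  "subring_of_domain_product R \<longleftrightarrow>
     (\<exists>(D\<^sub>1 :: 'a set ring) (D\<^sub>2 :: 'a set ring) S.
        domain D\<^sub>1 \<and> domain D\<^sub>2 \<and> subring S (RDirProd D\<^sub>1 D\<^sub>2) \<and>
        R \<simeq> (RDirProd D\<^sub>1 D\<^sub>2)\<lparr>carrier := S\<rparr>)"

lemma primeideal_kernel_into_domain:
  assumes R: "cring R" and D: "domain D" and h: "h \<in> ring_hom R D"
  shows "primeideal {r \<in> carrier R. h r = \<zero>\<^bsub>D\<^esub>} R"
proof -
  interpret D: domain D by (fact D)
  interpret R: cring R by (fact R)
  interpret ring_hom_ring R D h
    by (rule ring_hom_ringI2[OF R.ring_axioms D.ring_axioms h])
  show ?thesis
    using primeideal_vimage[OF R D.zeroprimeideal] by simp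
qed

lemma subring_of_domain_product_any_type:
  fixes R :: "('a, 'm) ring_scheme"
    and D\<^sub>1 :: "('b, 'k) ring_scheme" and D\<^sub>2 :: "('c, 'l) ring_scheme"
  assumes R: "cring R" and D: "domain D\<^sub>1" "domain D\<^sub>2"
    and S: "subring S (RDirProd D\<^sub>1 D\<^sub>2)"
    and iso: "R \<simeq> (RDirProd D\<^sub>1 D\<^sub>2)\<lparr>carrier := S\<rparr>"
  shows "subring_of_domain_product R"
proof -
  interpret R: cring R by (fact R)
  interpret D1: domain D\<^sub>1 by (fact D(1))
  interpret D2: domain D\<^sub>2 by (fact D(2))
  from iso obtain h where h: "h \<in> ring_iso R ((RDirProd D\<^sub>1 D\<^sub>2)\<lparr>carrier := S\<rparr>)"
    unfolding is_ring_iso_def by blast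
  have S_sub: "S \<subseteq> carrier D\<^sub>1 \<times> carrier D\<^sub>2"
    using subringE(1)[OF S] by (simp add: RDirProd_carrier)
  have h_inj: "inj_on h (carrier R)"
    using h by (auto simp: ring_iso_def bij_betw_def)
  have h1: "fst \<circ> h \<in> ring_hom R D\<^sub>1" and h2: "snd \<circ> h \<in> ring_hom R D\<^sub>2"
    using h S_sub
    by (auto simp: ring_iso_def ring_hom_def RDirProd_def DirProd_def monoid.defs
        Pi_iff subset_iff split: prod.splits) (metis prod.collapse mem_Sigma_iff prod.sel)+
  define P where "P = {r \<in> carrier R. (fst \<circ> h) r = \<zero>\<^bsub>D\<^sub>1\<^esub>}"
  define Q where "Q = {r \<in> carrier R. (snd \<circ> h) r = \<zero>\<^bsub>D\<^sub>2\<^esub>}"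
  have P: "primeideal P R" and Q: "primeideal Q R"
    unfolding P_def Q_def
    by (rule primeideal_kernel_into_domain[OF R D(1) h1],
        rule primeideal_kernel_into_domain[OF R D(2) h2])
  interpret P: primeideal P R by (fact P)
  interpret Q: primeideal Q R by (fact Q)
  let ?E = "RDirProd (R Quot P) (R Quot Q)"
  let ?g = "\<lambda>a. (P +>\<^bsub>R\<^esub> a, Q +>\<^bsub>R\<^esub> a)"
  have E: "ring ?E"
    by (rule RDirProd_ring[OF P.quotient_is_ring Q.quotient_is_ring])
  have g: "?g \<in> ring_hom R ?E"
    using P.rcos_ring_hom Q.rcos_ring_hom
    by (auto simp: ring_hom_def RDirProd_def DirProd_def monoid.defs)
  interpret g: ring_hom_ring R ?E ?g
    by (rule ring_hom_ringI2[OF R.ring_axioms E g])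
  have PQ: "P \<inter> Q \<subseteq> {\<zero>\<^bsub>R\<^esub>}"
  proof
    fix r assume r: "r \<in> P \<inter> Q"
    have "h \<zero>\<^bsub>R\<^esub> = (\<zero>\<^bsub>D\<^sub>1\<^esub>, \<zero>\<^bsub>D\<^sub>2\<^esub>)"
      using ring_hom_zero[OF h1 R.ring_axioms D1.ring_axioms]
        ring_hom_zero[OF h2 R.ring_axioms D2.ring_axioms]
      by (simp add: prod_eq_iff)
    moreover from r have "fst (h r) = \<zero>\<^bsub>D\<^sub>1\<^esub>" "snd (h r) = \<zero>\<^bsub>D\<^sub>2\<^esub>"
      unfolding P_def Q_def by auto
    then have "h r = (\<zero>\<^bsub>D\<^sub>1\<^esub>, \<zero>\<^bsub>D\<^sub>2\<^esub>)"
      by (cases "h r") auto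
    ultimately have "h r = h \<zero>\<^bsub>R\<^esub>" by (simp only:)
    moreover have "r \<in> carrier R" using r unfolding P_def by blast
    ultimately show "r \<in> {\<zero>\<^bsub>R\<^esub>}"
      using inj_onD[OF h_inj, of r "\<zero>\<^bsub>R\<^esub>"] by blast
  qed
  have "inj_on ?g (carrier R)"
  proof (rule inj_onI)
    fix a b assume ab: "a \<in> carrier R" "b \<in> carrier R" "?g a = ?g b"
    then have "a \<ominus>\<^bsub>R\<^esub> b \<in> P \<inter> Q"
      using R.quotient_eq_iff_same_a_r_cos[OF P.ideal_axioms]
        R.quotient_eq_iff_same_a_r_cos[OF Q.ideal_axioms] by blast
    then show "a = b"
      using PQ R.r_right_minus_eq[of a b] ab(1,2) by blast
  qed
  then have "?g \<in> ring_iso R (?E\<lparr>carrier := ?g ` carrier R\<rparr>)"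
    using g by (auto simp: ring_iso_def ring_hom_def bij_betw_def)
  moreover have "subring (?g ` carrier R) ?E"
    by (rule g.img_is_subring[OF R.carrier_is_subring])
  ultimately show ?thesis
    unfolding subring_of_domain_product_def is_ring_iso_def
    using P.quotient_is_domain Q.quotient_is_domain by blast
qed

end

theory Submission
  imports Defs
begin

text \<open>
  By McCoy's theorem a polynomial is a zero-divisor iff its coefficients have a common nonzero
  annihilator in \<open>R\<close>; the multivariate case follows from the univariate one by Kronecker
  substitution. Hence the zero-divisors of a polynomial ring form an ideal iff (c) holds.
  If the graph is complete but there are zero-divisors \<open>f\<close>, \<open>g\<close> with \<open>f + g\<close> regular, then
  \<open>f g = 0\<close>, and the annihilators of \<open>f\<close> and \<open>g\<close> in \<open>R\<close> are prime ideals with zero intersection, so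
  \<open>R\<close> embeds into the product of the two quotients. Conversely, let \<open>P \<inter> Q = 0\<close> for primes \<open>P\<close>, \<open>Q\<close>.
  A nonzero \<open>r\<close> that annihilates a polynomial lies outside \<open>P\<close> or outside \<open>Q\<close>, so that all
  coefficients of the polynomial lie in \<open>P\<close> or all lie in \<open>Q\<close>.
\<close>

section \<open>Ideals of the ring on a type\<close>

lemma ring_of_type_algebra_simps [simp]:
  "carrier (ring_of_type_algebra :: 'a::comm_ring_1 ring) = UNIV"
  "x \<otimes>\<^bsub>ring_of_type_algebra\<^esub> y = (x * y :: 'a)"
  "x \<oplus>\<^bsub>ring_of_type_algebra\<^esub> y = (x + y :: 'a)"
  "\<zero>\<^bsub>ring_of_type_algebra\<^esub> = (0 :: 'a)"
  "\<one>\<^bsub>ring_of_type_algebra\<^esub> = (1 :: 'a)"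
  by (simp_all add: ring_of_type_algebra_def)

lemma ideal_ring_of_type_algebra_iff:
  fixes I :: "'a::comm_ring_1 set"
  shows "ideal I ring_of_type_algebra \<longleftrightarrow>
    0 \<in> I \<and> (\<forall>x\<in>I. \<forall>y\<in>I. x + y \<in> I) \<and> (\<forall>x\<in>I. \<forall>r. r * x \<in> I)"
    (is "_ \<longleftrightarrow> ?rhs")
proof
  assume "ideal I ring_of_type_algebra"
  then interpret ideal I "ring_of_type_algebra :: 'a ring" .
  show ?rhs
    using additive_subgroup.zero_closed[OF is_additive_subgroup]
      additive_subgroup.a_closed[OF is_additive_subgroup] I_l_closed by simp
next
  assume I: ?rhs
  interpret R: cring "ring_of_type_algebra :: 'a ring"
    by (rule cring_from_type_algebra)
  have "\<ominus>\<^bsub>ring_of_type_algebra\<^esub> x = - 1 * x" for x :: 'a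
    by (rule R.minus_equality) auto
  then have minus: "\<ominus>\<^bsub>ring_of_type_algebra\<^esub> x \<in> I" if "x \<in> I" for x :: 'a
    using I that by metis
  have "subgroup I (add_monoid (ring_of_type_algebra :: 'a ring))"
    by (rule R.add.subgroupI) (use I minus in \<open>auto simp flip: a_inv_def\<close>)
  then show "ideal I ring_of_type_algebra"
    using I R.ring_axioms by (intro idealI) (auto simp: mult.commute)
qed

lemma primeideal_ring_of_type_algebra_iff:
  fixes P :: "'a::comm_ring_1 set"
  shows "primeideal P ring_of_type_algebra \<longleftrightarrow>
    ideal P ring_of_type_algebra \<and> 1 \<notin> P \<and> (\<forall>a b. a * b \<in> P \<longrightarrow> a \<in> P \<or> b \<in> P)"
    (is "_ \<longleftrightarrow> ?rhs")
proof
  assume "primeideal P ring_of_type_algebra"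
  then interpret primeideal P "ring_of_type_algebra :: 'a ring" .
  show ?rhs
    using I_notcarr I_prime one_imp_carrier is_ideal by auto
next
  assume ?rhs
  then show "primeideal P ring_of_type_algebra"
    using cring_from_type_algebra by (intro primeidealI) auto
qed

text \<open>The elements killed by a fixed \<open>r\<close> form an ideal, so an \<open>r\<close>
  that kills the generators kills all that they generate.\<close>

lemma annihilator_genideal:
  fixes S :: "'a::comm_ring_1 set"
  shows "annihilator (Idl\<^bsub>ring_of_type_algebra\<^esub> S) = annihilator S"
proof -
  interpret R: cring "ring_of_type_algebra :: 'a ring"
    by (rule cring_from_type_algebra)
  have "r \<in> annihilator (Idl\<^bsub>ring_of_type_algebra\<^esub> S)" if r: "r \<in> annihilator S" for r
  proof -
    have "ideal {x. r * x = 0} ring_of_type_algebra"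
      unfolding ideal_ring_of_type_algebra_iff
      by (auto simp: distrib_left mult.left_commute)
    then have "Idl\<^bsub>ring_of_type_algebra\<^esub> S \<subseteq> {x. r * x = 0}"
      by (rule R.genideal_minimal) (use r in \<open>auto simp: annihilator_def\<close>)
    then show ?thesis
      by (auto simp: annihilator_def)
  qed
  moreover have "S \<subseteq> Idl\<^bsub>ring_of_type_algebra\<^esub> S"
    by (rule R.genideal_self) simp
  ultimately show ?thesis
    by (auto simp: annihilator_def)
qed

lemma annihilator_neq_zero_iff: "annihilator S \<noteq> {0} \<longleftrightarrow> (\<exists>r. r \<noteq> 0 \<and> (\<forall>s\<in>S. r * s = 0))"
proof -
  have "0 \<in> annihilator S"
    by (simp add: annihilator_def)
  then show ?thesis
    by (auto simp: annihilator_def)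
qed

lemma zero_divisors_mult: "x \<in> zero_divisors \<Longrightarrow> r * x \<in> zero_divisors"
  unfolding zero_divisors_def mem_Collect_eq by (metis mult.assoc mult_zero_right)

text \<open>Multiples of zero-divisors are again zero-divisors, so only sums can fail to be.\<close>

lemma ideal_zero_divisors_iff:
  "ideal (zero_divisors :: 'a::comm_ring_1 set) ring_of_type_algebra \<longleftrightarrow>
    (\<forall>x\<in>zero_divisors. \<forall>y\<in>zero_divisors. x + y \<in> (zero_divisors :: 'a set))"
proof -
  have "(0 :: 'a) \<in> zero_divisors"
    by (auto simp: zero_divisors_def intro: exI[of _ 1])
  then show ?thesis
    by (auto simp: ideal_ring_of_type_algebra_iff zero_divisors_mult)
qed

lemma complete_zd_graph_iff:
  "complete_sgraph (zd_graph :: 'a::comm_ring_1 sgraph) \<longleftrightarrow>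
    (\<forall>x\<in>zero_divisors. \<forall>y\<in>zero_divisors. x * y = 0 \<or> x + y \<in> (zero_divisors :: 'a set))"
    (is "_ \<longleftrightarrow> ?rhs")
proof
  assume G: "complete_sgraph (zd_graph :: 'a sgraph)"
  show ?rhs
  proof (intro ballI)
    fix x y :: 'a
    assume xy: "x \<in> zero_divisors" "y \<in> zero_divisors"
    show "x * y = 0 \<or> x + y \<in> zero_divisors"
    proof (cases "x = 0 \<or> y = 0 \<or> x = y")
      \<comment> \<open>Such pairs are no edges but satisfy the condition anyway: the product is 0,
        or the sum is \<open>2 * x\<close>.\<close>
      case True
      then show ?thesis
        using xy zero_divisors_mult[of x 2] by auto
    next
      case False
      then have "{x, y} \<in> snd (zd_graph :: 'a sgraph)"
        using G xy by (auto simp: complete_sgraph_def zd_graph_def)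
      then show ?thesis
        by (auto simp: zd_graph_def doubleton_eq_iff mult.commute add.commute)
    qed
  qed
next
  assume ?rhs
  then show "complete_sgraph (zd_graph :: 'a sgraph)"
    by (auto simp: complete_sgraph_def zd_graph_def)
qed

text \<open>If the zero-divisors form an ideal, it contains the ideal generated by finitely many of
  them, and property A applies to the latter. Conversely, a common annihilator of \<open>x\<close>
  and \<open>y\<close> kills \<open>x + y\<close>, which gives closure under sums.\<close>

lemma property_A_and_ideal_zero_divisors_iff:
  "property_A TYPE('a::comm_ring_1) \<and> ideal (zero_divisors :: 'a set) ring_of_type_algebra \<longleftrightarrow>
    (\<forall>S :: 'a set. finite S \<and> S \<subseteq> zero_divisors \<longrightarrow> annihilator S \<noteq> {0})"
    (is "?b \<longleftrightarrow> ?c")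
proof
  interpret R: cring "ring_of_type_algebra :: 'a ring"
    by (rule cring_from_type_algebra)
  assume b: ?b
  show ?c
  proof (intro allI impI)
    fix S :: "'a set"
    assume S: "finite S \<and> S \<subseteq> zero_divisors"
    then have "Idl\<^bsub>ring_of_type_algebra\<^esub> S \<subseteq> zero_divisors"
      using b by (intro R.genideal_minimal) auto
    moreover have "fin_gen_ideal (Idl\<^bsub>ring_of_type_algebra\<^esub> S)"
      using S by (auto simp: fin_gen_ideal_def)
    ultimately have "annihilator (Idl\<^bsub>ring_of_type_algebra\<^esub> S) \<noteq> {0}"
      using b unfolding property_A_def by blast
    then show "annihilator S \<noteq> {0}"
      by (simp add: annihilator_genideal)
  qed
next
  interpret R: cring "ring_of_type_algebra :: 'a ring"
    by (rule cring_from_type_algebra)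
  assume c: ?c
  have "annihilator I \<noteq> {0}" if I: "fin_gen_ideal I" "I \<subseteq> zero_divisors" for I :: "'a set"
  proof -
    obtain S where S: "finite S" "I = Idl\<^bsub>ring_of_type_algebra\<^esub> S"
      using I by (auto simp: fin_gen_ideal_def)
    moreover have "S \<subseteq> Idl\<^bsub>ring_of_type_algebra\<^esub> S"
      by (rule R.genideal_self) simp
    ultimately show ?thesis
      using c I by (simp add: annihilator_genideal)
  qed
  moreover have "x + y \<in> zero_divisors" if "x \<in> zero_divisors" "y \<in> zero_divisors" for x y :: 'a
  proof -
    have "annihilator {x, y} \<noteq> {0}"
      using c that by simp
    then obtain r where "r \<noteq> 0" "r * x = 0" "r * y = 0"
      by (auto simp: annihilator_neq_zero_iff)
    then have "(x + y) * r = 0"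
      by (simp add: algebra_simps)
    then show ?thesis
      using \<open>r \<noteq> 0\<close> by (auto simp: zero_divisors_def)
  qed
  ultimately show ?b
    by (auto simp: property_A_def ideal_zero_divisors_iff)
qed

text \<open>The primes are the kernels of the two components of an embedding. Conversely, the map
  into the product of the two quotients has kernel \<open>P \<inter> Q\<close>, and the quotients
  consist of cosets, as the type of the domains requires.\<close>

lemma subring_of_domain_product_iff:
  "subring_of_domain_product (ring_of_type_algebra :: 'a::comm_ring_1 ring) \<longleftrightarrow>
    (\<exists>P Q :: 'a set. primeideal P ring_of_type_algebra \<and> primeideal Q ring_of_type_algebra \<and>
      P \<inter> Q \<subseteq> {0})" (is "?l \<longleftrightarrow> ?r")
proof
  let ?R = "ring_of_type_algebra :: 'a ring"
  have R: "cring ?R"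
    by (rule cring_from_type_algebra)
  assume ?l
  then obtain D1 D2 :: "'a set ring" and S h
    where D: "domain D1" "domain D2" and S: "subring S (RDirProd D1 D2)"
      and h: "h \<in> ring_iso ?R ((RDirProd D1 D2)\<lparr>carrier := S\<rparr>)"
    unfolding subring_of_domain_product_def is_ring_iso_def by blast
  interpret D1: domain D1 by (fact D(1))
  interpret D2: domain D2 by (fact D(2))
  have S_sub: "S \<subseteq> carrier D1 \<times> carrier D2"
    using subringE(1)[OF S] by (simp add: RDirProd_carrier)
  have hom: "fst \<circ> h \<in> ring_hom ?R D1" "snd \<circ> h \<in> ring_hom ?R D2"
    using h S_sub
    by (auto simp: ring_iso_def ring_hom_def RDirProd_def DirProd_def monoid.defs
        Pi_iff subset_iff split: prod.splits) (metis prod.collapse mem_Sigma_iff prod.sel)+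
  have "inj h"
    using h by (auto simp: ring_iso_def bij_betw_def)
  moreover have "h 0 = (\<zero>\<^bsub>D1\<^esub>, \<zero>\<^bsub>D2\<^esub>)"
    using ring_hom_zero[OF hom(1) cring.axioms(1)[OF R] D1.ring_axioms]
      ring_hom_zero[OF hom(2) cring.axioms(1)[OF R] D2.ring_axioms]
    by (simp add: prod_eq_iff)
  ultimately have "{r. fst (h r) = \<zero>\<^bsub>D1\<^esub>} \<inter> {r. snd (h r) = \<zero>\<^bsub>D2\<^esub>} \<subseteq> {0}"
    by (auto simp: inj_def) (metis prod.collapse)
  then show ?r
    using primeideal_kernel_into_domain[OF R D(1) hom(1)]
      primeideal_kernel_into_domain[OF R D(2) hom(2)] by auto
next
  let ?R = "ring_of_type_algebra :: 'a ring"
  interpret R: cring ?R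
    by (rule cring_from_type_algebra)
  assume ?r
  then obtain P Q :: "'a set"
    where P: "primeideal P ?R" and Q: "primeideal Q ?R" and PQ: "P \<inter> Q \<subseteq> {0}"
    by blast
  interpret P: primeideal P ?R by (fact P)
  interpret Q: primeideal Q ?R by (fact Q)
  let ?E = "RDirProd (?R Quot P) (?R Quot Q)"
  let ?g = "\<lambda>a. (P +>\<^bsub>?R\<^esub> a, Q +>\<^bsub>?R\<^esub> a)"
  have g: "?g \<in> ring_hom ?R ?E"
    using P.rcos_ring_hom Q.rcos_ring_hom
    by (auto simp: ring_hom_def RDirProd_def DirProd_def monoid.defs)
  interpret g: ring_hom_ring ?R ?E ?g
    by (rule ring_hom_ringI2[OF R.ring_axioms
          RDirProd_ring[OF P.quotient_is_ring Q.quotient_is_ring] g])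
  have "inj ?g"
  proof (rule injI)
    fix a b assume "?g a = ?g b"
    then have "a \<ominus>\<^bsub>?R\<^esub> b \<in> P \<inter> Q"
      using R.quotient_eq_iff_same_a_r_cos[OF P.ideal_axioms, of a b]
        R.quotient_eq_iff_same_a_r_cos[OF Q.ideal_axioms, of a b] by simp
    then show "a = b"
      using PQ R.r_right_minus_eq[of a b] by auto
  qed
  then have "?g \<in> ring_iso ?R (?E\<lparr>carrier := range ?g\<rparr>)"
    using g by (auto simp: ring_iso_def ring_hom_def bij_betw_def)
  moreover have "subring (range ?g) ?E"
    using g.img_is_subring[OF R.carrier_is_subring] by simp
  ultimately show ?l
    unfolding subring_of_domain_product_def is_ring_iso_def
    using P.quotient_is_domain Q.quotient_is_domain
    by (intro exI[of _ "?R Quot P"] exI[of _ "?R Quot Q"] exI[of _ "range ?g"]) auto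
qed

section \<open>McCoy's theorem\<close>

text \<open>Induction on the degree of the annihilator \<open>g\<close>. If every coefficient of
  \<open>f\<close> kills \<open>g\<close>, the leading coefficient of \<open>g\<close> is the wanted
  \<open>r\<close>. Otherwise multiplying \<open>g\<close> by a suitable coefficient of
  \<open>f\<close> gives a nonzero annihilator of smaller degree.\<close>

lemma McCoy_poly:
  fixes f g :: "'a::comm_ring_1 poly"
  assumes "f * g = 0" "g \<noteq> 0"
  shows "\<exists>r. r \<noteq> 0 \<and> (\<forall>i. r * coeff f i = 0)"
  using assms
proof (induction "degree g" arbitrary: g rule: less_induct)
  case less
  show ?case
  proof (cases "\<forall>i. smult (coeff f i) g = 0")
    case True
    then have "lead_coeff g * coeff f i = 0" for i
      by (metis coeff_0 coeff_smult mult.commute)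
    then show ?thesis
      using \<open>g \<noteq> 0\<close> by (metis leading_coeff_0_iff)
  next
    case False
    \<comment> \<open>The last index in \<open>I\<close> supplies the suitable coefficient: all
      later coefficients of \<open>f\<close> kill \<open>g\<close>.\<close>
    define I where "I = {i. smult (coeff f i) g \<noteq> 0}"
    have "I \<subseteq> {..degree f}"
      unfolding I_def by (auto intro: le_degree)
    then have "finite I"
      by (rule finite_subset) simp
    moreover have "I \<noteq> {}"
      using False by (auto simp: I_def)
    ultimately have m: "Max I \<in> I"
      by (rule Max_in)
    have above: "i \<notin> I" if "i > Max I" for i
      using Max_ge[OF \<open>finite I\<close>, of i] that by auto
    let ?m = "Max I" and ?d = "degree g"
    \<comment> \<open>Terms with \<open>k < ?m\<close> involve a coefficient of \<open>g\<close>
      beyond its degree, and those with \<open>k > ?m\<close> vanish by the choice of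
      \<open>?m\<close>.\<close>
    have "0 = coeff (f * g) (?m + ?d)"
      using less.prems by simp
    also have "\<dots> = (\<Sum>k\<le>?m + ?d. coeff f k * coeff g (?m + ?d - k))"
      by (rule coeff_mult)
    also have "\<dots> = (\<Sum>k\<in>{?m}. coeff f k * coeff g (?m + ?d - k))"
    proof (rule sum.mono_neutral_right)
      show "\<forall>k\<in>{..?m + ?d} - {?m}. coeff f k * coeff g (?m + ?d - k) = 0"
      proof
        fix k
        assume k: "k \<in> {..?m + ?d} - {?m}"
        show "coeff f k * coeff g (?m + ?d - k) = 0"
        proof (cases "k < ?m")
          case True
          then show ?thesis
            by (simp add: coeff_eq_0)
        next
          case False
          then have "smult (coeff f k) g = 0"
            using above[of k] k by (auto simp: I_def)
          then show ?thesis
            by (metis coeff_0 coeff_smult)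
        qed
      qed
    qed auto
    finally have lead: "coeff f ?m * lead_coeff g = 0"
      by simp
    let ?h = "smult (coeff f ?m) g"
    have "?h \<noteq> 0"
      using m by (simp add: I_def)
    \<comment> \<open>The factor kills the leading coefficient of \<open>g\<close>, so the degree
      drops.\<close>
    moreover have "degree ?h \<noteq> ?d"
      using lead \<open>?h \<noteq> 0\<close> by (metis coeff_smult leading_coeff_0_iff)
    then have "degree ?h < ?d"
      using degree_smult_le[of "coeff f ?m" g] by simp
    moreover have "f * ?h = 0"
      using less.prems by simp
    ultimately show ?thesis
      using less.hyps by blast
  qed
qed

section \<open>Kronecker substitution and the multivariate case\<close>

lemma poly_mapping_eq_sum_single:
  "(p :: 'k \<Rightarrow>\<^sub>0 'a::comm_monoid_add) =
    (\<Sum>k\<in>Poly_Mapping.keys p. Poly_Mapping.single k (Poly_Mapping.lookup p k))"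
proof (rule poly_mapping_eqI)
  fix j
  show "Poly_Mapping.lookup p j = Poly_Mapping.lookup
    (\<Sum>k\<in>Poly_Mapping.keys p. Poly_Mapping.single k (Poly_Mapping.lookup p k)) j"
    by (simp add: lookup_sum lookup_single when_def in_keys_iff)
qed

text \<open>Cancellation makes \<open>k\<close> the only exponent that is shifted to
  \<open>e + k\<close>.\<close>

lemma lookup_single_mult:
  fixes e k :: "'k::cancel_comm_monoid_add" and p :: "'k \<Rightarrow>\<^sub>0 'a::comm_ring_1"
  shows "Poly_Mapping.lookup (Poly_Mapping.single e r * p) (e + k) = r * Poly_Mapping.lookup p k"
  by (simp add: lookup_mult lookup_single when_mult)

text \<open>The weight \<open>w\<close> stays a parameter because a weight that separates exponents
  depends on the polynomials at hand.\<close>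

definition kronecker :: "('k \<Rightarrow> nat) \<Rightarrow> ('k \<Rightarrow>\<^sub>0 'a::comm_ring_1) \<Rightarrow> 'a poly" where
  "kronecker w p = (\<Sum>k\<in>Poly_Mapping.keys p. monom (Poly_Mapping.lookup p k) (w k))"

lemma kronecker_single: "kronecker w (Poly_Mapping.single k a) = monom a (w k)"
  by (simp add: kronecker_def)

lemma kronecker_add: "kronecker w (p + q) = kronecker w p + kronecker w q"
proof -
  let ?K = "Poly_Mapping.keys p \<union> Poly_Mapping.keys q"
  have *: "kronecker w s = (\<Sum>k\<in>?K. monom (Poly_Mapping.lookup s k) (w k))"
    if "Poly_Mapping.keys s \<subseteq> ?K" for s
    unfolding kronecker_def
    by (rule sum.mono_neutral_left) (use that in \<open>auto simp: in_keys_iff\<close>)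
  show ?thesis
    using keys_add[of p q]
    by (simp add: * lookup_add sum.distrib flip: add_monom)
qed

lemma kronecker_sum: "kronecker w (\<Sum>i\<in>I. p i) = (\<Sum>i\<in>I. kronecker w (p i))"
  by (induction I rule: infinite_finite_induct) (simp_all add: kronecker_add, simp_all add: kronecker_def)

text \<open>Both factors are split into single terms, where additivity of \<open>w\<close> turns
  sums of exponent vectors into sums of degrees.\<close>

lemma kronecker_mult:
  assumes w: "\<And>k l. w (k + l) = w k + w l"
  shows "kronecker w (p * q) = kronecker w p * kronecker w q"
proof -
  have "kronecker w (p * q) = kronecker w
    ((\<Sum>k\<in>Poly_Mapping.keys p. Poly_Mapping.single k (Poly_Mapping.lookup p k)) *
     (\<Sum>l\<in>Poly_Mapping.keys q. Poly_Mapping.single l (Poly_Mapping.lookup q l)))"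
    by (simp flip: poly_mapping_eq_sum_single)
  also have "\<dots> = kronecker w p * kronecker w q"
    by (simp add: sum_product mult_single kronecker_sum kronecker_single w mult_monom)
      (simp add: kronecker_def sum_product mult_monom)
  finally show ?thesis .
qed

text \<open>Injectivity keeps all other terms from landing on the power \<open>w k\<close>.\<close>

lemma coeff_kronecker:
  assumes "inj_on w (Poly_Mapping.keys p)" "k \<in> Poly_Mapping.keys p"
  shows "coeff (kronecker w p) (w k) = Poly_Mapping.lookup p k"
proof -
  have "coeff (kronecker w p) (w k) =
    (\<Sum>l\<in>Poly_Mapping.keys p. if l = k then Poly_Mapping.lookup p l else 0)"
    unfolding kronecker_def coeff_sum coeff_monom
    by (rule sum.cong) (use assms in \<open>auto dest: inj_onD\<close>)
  then show ?thesis
    using assms by simp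
qed

text \<open>Positional notation: in the induction the exponent of the new variable becomes the last
  digit in a base \<open>M\<close> that exceeds all its values on \<open>K\<close>.\<close>

lemma separating_weights:
  fixes K :: "('v \<Rightarrow>\<^sub>0 nat) set"
  assumes "finite V" "finite K"
  shows "\<exists>c :: 'v \<Rightarrow> nat. \<forall>k\<in>K. \<forall>l\<in>K.
    (\<Sum>v\<in>V. c v * Poly_Mapping.lookup k v) = (\<Sum>v\<in>V. c v * Poly_Mapping.lookup l v) \<longrightarrow>
    (\<forall>v\<in>V. Poly_Mapping.lookup k v = Poly_Mapping.lookup l v)"
  using assms(1)
proof (induction V)
  case (insert u V)
  then obtain c :: "'v \<Rightarrow> nat" where c: "\<And>k l. k \<in> K \<Longrightarrow> l \<in> K \<Longrightarrow>
    (\<Sum>v\<in>V. c v * Poly_Mapping.lookup k v) = (\<Sum>v\<in>V. c v * Poly_Mapping.lookup l v) \<Longrightarrow>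
    \<forall>v\<in>V. Poly_Mapping.lookup k v = Poly_Mapping.lookup l v"
    by blast
  obtain M where M: "\<And>k. k \<in> K \<Longrightarrow> Poly_Mapping.lookup k u < M"
    using \<open>finite K\<close> finite_nat_set_iff_bounded[of "(\<lambda>k. Poly_Mapping.lookup k u) ` K"] by auto
  define d where "d v = (if v = u then 1 else M * c v)" for v
  have d: "(\<Sum>v\<in>insert u V. d v * Poly_Mapping.lookup k v) =
    Poly_Mapping.lookup k u + M * (\<Sum>v\<in>V. c v * Poly_Mapping.lookup k v)" for k
  proof -
    have "(\<Sum>v\<in>V. d v * Poly_Mapping.lookup k v) = (\<Sum>v\<in>V. M * (c v * Poly_Mapping.lookup k v))"
      by (rule sum.cong) (use insert.hyps in \<open>auto simp: d_def\<close>)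
    then show ?thesis
      using insert.hyps by (simp add: d_def sum_distrib_left)
  qed
  have "\<forall>v\<in>insert u V. Poly_Mapping.lookup k v = Poly_Mapping.lookup l v"
    if kl: "k \<in> K" "l \<in> K" and eq: "(\<Sum>v\<in>insert u V. d v * Poly_Mapping.lookup k v) =
      (\<Sum>v\<in>insert u V. d v * Poly_Mapping.lookup l v)" for k l
  proof -
    have *: "Poly_Mapping.lookup k u + M * (\<Sum>v\<in>V. c v * Poly_Mapping.lookup k v) =
      Poly_Mapping.lookup l u + M * (\<Sum>v\<in>V. c v * Poly_Mapping.lookup l v)"
      using eq by (simp only: d)
    \<comment> \<open>The residue modulo \<open>M\<close> recovers the last digit. What remains can
      be divided by \<open>M\<close>, which is positive because it exceeds an exponent.\<close>
    from arg_cong[OF this, of "\<lambda>n. n mod M"] have u: "Poly_Mapping.lookup k u = Poly_Mapping.lookup l u"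
      using M kl by simp
    with * have "(\<Sum>v\<in>V. c v * Poly_Mapping.lookup k v) = (\<Sum>v\<in>V. c v * Poly_Mapping.lookup l v)"
      using M[OF kl(1)] by simp
    with c kl u show ?thesis
      by blast
  qed
  then show ?case
    by blast
qed simp

text \<open>The weight separates the exponents of \<open>f\<close>, so that its coefficients can be
  recovered, and those of \<open>g\<close>, so that its image stays nonzero. The univariate theorem
  then applies to the images.\<close>

lemma McCoy_mv_poly:
  fixes f g :: "('a::comm_ring_1, 'v::finite) mv_poly"
  assumes "f * g = 0" "g \<noteq> 0"
  shows "\<exists>r. r \<noteq> 0 \<and> (\<forall>k. r * Poly_Mapping.lookup f k = 0)"
proof -
  let ?K = "Poly_Mapping.keys f \<union> Poly_Mapping.keys g"
  obtain c :: "'v \<Rightarrow> nat" where c: "\<And>k l. k \<in> ?K \<Longrightarrow> l \<in> ?K \<Longrightarrow>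
    (\<Sum>v\<in>UNIV. c v * Poly_Mapping.lookup k v) = (\<Sum>v\<in>UNIV. c v * Poly_Mapping.lookup l v) \<Longrightarrow>
    \<forall>v. Poly_Mapping.lookup k v = Poly_Mapping.lookup l v"
    using separating_weights[of "UNIV :: 'v set" ?K] by auto
  define w where "w k = (\<Sum>v\<in>UNIV. c v * Poly_Mapping.lookup k v)" for k
  have add: "w (k + l) = w k + w l" for k l
    by (simp add: w_def lookup_add distrib_left sum.distrib)
  have inj: "inj_on w ?K"
  proof (rule inj_onI)
    fix k l
    assume "k \<in> ?K" "l \<in> ?K" "w k = w l"
    then have "\<forall>v. Poly_Mapping.lookup k v = Poly_Mapping.lookup l v"
      unfolding w_def by (rule c)
    then show "k = l"
      by (intro poly_mapping_eqI) blast
  qed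
  have "kronecker w f * kronecker w g = 0"
    using assms kronecker_mult[OF add, of f g] by (simp add: kronecker_def)
  moreover have "kronecker w g \<noteq> 0"
  proof -
    obtain k where "Poly_Mapping.lookup g k \<noteq> 0"
      using \<open>g \<noteq> 0\<close> by (metis lookup_zero poly_mapping_eqI)
    then show ?thesis
      using coeff_kronecker[of w g k] inj by (auto simp: in_keys_iff inj_on_Un)
  qed
  ultimately obtain r where r: "r \<noteq> 0" "\<And>i. r * coeff (kronecker w f) i = 0"
    using McCoy_poly by blast
  have "r * Poly_Mapping.lookup f k = 0" for k
    using coeff_kronecker[of w f k] inj r(2)[of "w k"]
    by (cases "k \<in> Poly_Mapping.keys f") (auto simp: inj_on_Un in_keys_iff)
  with r show ?thesis
    by blast
qed

section \<open>Zero-divisors of polynomial rings\<close>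

text \<open>Captures what univariate and multivariate polynomial rings share: \<open>C p\<close> is the set of
  coefficients of \<open>p\<close>.\<close>

locale coefficient_ring =
  fixes C :: "'b::comm_ring_1 \<Rightarrow> 'a::comm_ring_1 set"
  assumes finite_C: "finite (C p)"
    and C_zero: "C 0 = {0}"
    and C_add: "c \<in> C (p + q) \<Longrightarrow> \<exists>a\<in>C p. \<exists>b\<in>C q. c = a + b"
    and fresh_term: "\<exists>t. insert s (C p) \<subseteq> C (p + t) \<and> C t \<subseteq> {0, s}"
    and McCoy: "p \<in> zero_divisors \<longleftrightarrow> (\<exists>r. r \<noteq> 0 \<and> (\<forall>c\<in>C p. r * c = 0))"
begin

text \<open>In one direction, a zero-divisor having all of \<open>S\<close> among its coefficients
  is built term by term, and \<open>McCoy\<close> yields a common annihilator. In the other, the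
  coefficients of \<open>x\<close> and \<open>y\<close> are finitely many zero-divisors, and a
  common annihilator of them kills those of \<open>x + y\<close>.\<close>

lemma ideal_zero_divisors_iff_annihilator:
  "ideal (zero_divisors :: 'b set) ring_of_type_algebra \<longleftrightarrow>
    (\<forall>S :: 'a set. finite S \<and> S \<subseteq> zero_divisors \<longrightarrow> annihilator S \<noteq> {0})"
    (is "_ \<longleftrightarrow> ?c")
proof
  assume "ideal (zero_divisors :: 'b set) ring_of_type_algebra"
  then have add: "x + y \<in> zero_divisors" if "x \<in> zero_divisors" "y \<in> zero_divisors" for x y :: 'b
    using that by (simp add: ideal_zero_divisors_iff)
  have "\<exists>p\<in>zero_divisors. S \<subseteq> C p" if "finite S" "S \<subseteq> zero_divisors" for S
    using that
  proof (induction S)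
    case empty
    then show ?case
      using C_zero McCoy[of 0] by (auto intro: exI[of _ 1])
  next
    case (insert s S)
    then obtain p where p: "p \<in> zero_divisors" "S \<subseteq> C p"
      by auto
    \<comment> \<open>The new term has no coefficients but 0 and \<open>s\<close>, so it is killed
      by whatever kills \<open>s\<close>. The sum \<open>p + t\<close> is then a zero-divisor by
      closure.\<close>
    obtain t where t: "insert s (C p) \<subseteq> C (p + t)" "C t \<subseteq> {0, s}"
      using fresh_term by blast
    obtain r where "r \<noteq> 0" "s * r = 0"
      using insert.prems by (auto simp: zero_divisors_def)
    then have "\<forall>c\<in>C t. r * c = 0"
      using t(2) by (auto simp: mult.commute)
    with \<open>r \<noteq> 0\<close> have "t \<in> zero_divisors"
      by (auto simp: McCoy)
    with p t add show ?case
      by blast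
  qed
  then show ?c
    by (metis McCoy annihilator_neq_zero_iff subsetD)
next
  assume c: ?c
  have "x + y \<in> zero_divisors" if xy: "x \<in> zero_divisors" "y \<in> zero_divisors" for x y :: 'b
  proof -
    have "C p \<subseteq> zero_divisors" if "p \<in> zero_divisors" for p
      using that unfolding McCoy by (auto simp: zero_divisors_def) (metis mult.commute)
    then have "annihilator (C x \<union> C y) \<noteq> {0}"
      using c finite_C xy by simp
    then obtain r where "r \<noteq> 0" "\<forall>s\<in>C x \<union> C y. r * s = 0"
      by (auto simp: annihilator_neq_zero_iff)
    then show ?thesis
      using C_add[of _ x y] by (fastforce simp: McCoy distrib_left)
  qed
  then show "ideal (zero_divisors :: 'b set) ring_of_type_algebra"
    by (simp add: ideal_zero_divisors_iff)
qed

end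

lemma zero_divisors_poly_iff:
  "(p :: 'a::comm_ring_1 poly) \<in> zero_divisors \<longleftrightarrow> (\<exists>r. r \<noteq> 0 \<and> (\<forall>i. r * coeff p i = 0))"
proof
  assume "p \<in> zero_divisors"
  then show "\<exists>r. r \<noteq> 0 \<and> (\<forall>i. r * coeff p i = 0)"
    using McCoy_poly by (auto simp: zero_divisors_def)
next
  assume "\<exists>r. r \<noteq> 0 \<and> (\<forall>i. r * coeff p i = 0)"
  then obtain r where "r \<noteq> 0" "\<forall>i. r * coeff p i = 0"
    by blast
  then have "p * [:r:] = 0" "[:r:] \<noteq> 0"
    by (auto intro: poly_eqI)
  then show "p \<in> zero_divisors"
    unfolding zero_divisors_def by blast
qed

lemma zero_divisors_mv_poly_iff:
  "(p :: ('a::comm_ring_1, 'v::finite) mv_poly) \<in> zero_divisors \<longleftrightarrow>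
    (\<exists>r. r \<noteq> 0 \<and> (\<forall>k. r * Poly_Mapping.lookup p k = 0))"
proof
  assume "p \<in> zero_divisors"
  then show "\<exists>r. r \<noteq> 0 \<and> (\<forall>k. r * Poly_Mapping.lookup p k = 0)"
    using McCoy_mv_poly by (auto simp: zero_divisors_def)
next
  assume "\<exists>r. r \<noteq> 0 \<and> (\<forall>k. r * Poly_Mapping.lookup p k = 0)"
  then obtain r where r: "r \<noteq> 0" "\<forall>k. r * Poly_Mapping.lookup p k = 0"
    by blast
  have "Poly_Mapping.lookup (Poly_Mapping.single 0 r * p) k = 0" for k
    using lookup_single_mult[of 0 r p k] r by simp
  then have "p * Poly_Mapping.single 0 r = 0"
    by (metis lookup_zero mult.commute poly_mapping_eqI)
  moreover have "Poly_Mapping.single 0 r \<noteq> (0 :: ('a, 'v) mv_poly)"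
    using r by (metis lookup_single_eq lookup_zero)
  ultimately show "p \<in> zero_divisors"
    unfolding zero_divisors_def by blast
qed

text \<open>Provides exponents outside any finite set, for fresh terms and for shifts.\<close>

lemma infinite_exponents: "infinite (UNIV :: ('v \<Rightarrow>\<^sub>0 nat) set)"
proof -
  have "inj (\<lambda>d. Poly_Mapping.single undefined d :: 'v \<Rightarrow>\<^sub>0 nat)"
    by simp
  then show ?thesis
    using finite_imageD[of "\<lambda>d. Poly_Mapping.single undefined d :: 'v \<Rightarrow>\<^sub>0 nat" UNIV]
      finite_subset[OF subset_UNIV] by auto
qed

interpretation poly: coefficient_ring "\<lambda>p :: 'a::comm_ring_1 poly. range (coeff p)"
proof
  fix p q :: "'a poly" and s c :: 'a
  show "finite (range (coeff p))"
    by (rule finite_subset[of _ "insert 0 (coeff p ` {..degree p})"])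
      (auto, metis atMost_iff coeff_eq_0 imageI not_le)
  show "range (coeff (0 :: 'a poly)) = {0}"
    by auto
  show "\<exists>a\<in>range (coeff p). \<exists>b\<in>range (coeff q). c = a + b" if "c \<in> range (coeff (p + q))"
    using that by auto
  have "s \<in> range (coeff (p + monom s (Suc (degree p))))"
    by (intro range_eqI[of _ _ "Suc (degree p)"]) (simp add: coeff_eq_0)
  moreover have "coeff p i \<in> range (coeff (p + monom s (Suc (degree p))))" for i
  proof (cases "i \<le> degree p")
    case True
    then show ?thesis
      by (intro range_eqI[of _ _ i]) simp
  next
    \<comment> \<open>The coefficient is 0. Since \<open>s\<close> occupies the first place above
      the degree, the value 0 is found one place higher.\<close>
    case False
    then show ?thesis
      by (intro range_eqI[of _ _ "Suc (Suc (degree p))"]) (simp add: coeff_eq_0)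
  qed
  ultimately show "\<exists>t. insert s (range (coeff p)) \<subseteq> range (coeff (p + t)) \<and> range (coeff t) \<subseteq> {0, s}"
    by (intro exI[of _ "monom s (Suc (degree p))"]) auto
  show "p \<in> zero_divisors \<longleftrightarrow> (\<exists>r. r \<noteq> 0 \<and> (\<forall>c\<in>range (coeff p). r * c = 0))"
    by (simp add: zero_divisors_poly_iff)
qed

interpretation mv_poly: coefficient_ring
  "\<lambda>p :: ('a::comm_ring_1, 'v::finite) mv_poly. range (Poly_Mapping.lookup p)"
proof
  fix p q :: "('a, 'v) mv_poly" and s c :: 'a
  show "finite (range (Poly_Mapping.lookup p))"
    by (rule finite_subset[of _ "insert 0 (Poly_Mapping.lookup p ` Poly_Mapping.keys p)"])
      (auto simp: in_keys_iff)
  show "range (Poly_Mapping.lookup (0 :: ('a, 'v) mv_poly)) = {0}"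
    by auto
  show "\<exists>a\<in>range (Poly_Mapping.lookup p). \<exists>b\<in>range (Poly_Mapping.lookup q). c = a + b"
    if "c \<in> range (Poly_Mapping.lookup (p + q))"
    using that by (auto simp: lookup_add)
  obtain e where e: "e \<notin> Poly_Mapping.keys p"
    using ex_new_if_finite[OF infinite_exponents, of "Poly_Mapping.keys p"] by auto
  \<comment> \<open>Position \<open>e\<close> will hold \<open>s\<close>; the second free exponent
    shows that the value 0 is still a coefficient.\<close>
  obtain e' where e': "e' \<notin> insert e (Poly_Mapping.keys p)"
    using ex_new_if_finite[OF infinite_exponents, of "insert e (Poly_Mapping.keys p)"] by auto
  let ?t = "Poly_Mapping.single e s"
  have "s \<in> range (Poly_Mapping.lookup (p + ?t))"
    using e by (intro range_eqI[of _ _ e]) (simp add: lookup_add in_keys_iff)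
  moreover have "Poly_Mapping.lookup p k \<in> range (Poly_Mapping.lookup (p + ?t))" for k
  proof (cases "k = e")
    case True
    then show ?thesis
      using e e' by (intro range_eqI[of _ _ e']) (auto simp: lookup_add lookup_single in_keys_iff)
  next
    case False
    then show ?thesis
      by (intro range_eqI[of _ _ k]) (simp add: lookup_add lookup_single)
  qed
  ultimately show "\<exists>t. insert s (range (Poly_Mapping.lookup p)) \<subseteq> range (Poly_Mapping.lookup (p + t)) \<and>
    range (Poly_Mapping.lookup t) \<subseteq> {0, s}"
    by (intro exI[of _ ?t]) (auto simp: lookup_single when_def)
  show "p \<in> zero_divisors \<longleftrightarrow> (\<exists>r. r \<noteq> 0 \<and> (\<forall>c\<in>range (Poly_Mapping.lookup p). r * c = 0))"
    by (simp add: zero_divisors_mv_poly_iff)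
qed

section \<open>Completeness of the graph and pairs of prime ideals\<close>

lemma zero_divisors_mv_poly_of_primes:
  fixes P Q :: "'a::comm_ring_1 set"
  assumes P: "primeideal P ring_of_type_algebra" and Q: "primeideal Q ring_of_type_algebra"
    and PQ: "P \<inter> Q \<subseteq> {0}"
    and x: "x \<in> zero_divisors" and y: "y \<in> zero_divisors"
  shows "x * y = 0 \<or> x + y \<in> (zero_divisors :: ('a, 'v::finite) mv_poly set)"
proof -
  have id: "0 \<in> I" "\<And>u v. u \<in> I \<Longrightarrow> v \<in> I \<Longrightarrow> u + v \<in> I"
    "\<And>u r. u \<in> I \<Longrightarrow> r * u \<in> I" "\<And>u v. u * v \<in> I \<Longrightarrow> u \<in> I \<or> v \<in> I" if "I \<in> {P, Q}" for I
    using P Q that by (auto simp: primeideal_ring_of_type_algebra_iff ideal_ring_of_type_algebra_iff)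
  have side: "(\<forall>k. Poly_Mapping.lookup z k \<in> P) \<or> (\<forall>k. Poly_Mapping.lookup z k \<in> Q)"
    if "z \<in> zero_divisors" for z :: "('a, 'v) mv_poly"
  proof -
    obtain r where r: "r \<noteq> 0" "\<And>k. r * Poly_Mapping.lookup z k = 0"
      using \<open>z \<in> zero_divisors\<close> by (auto simp: zero_divisors_mv_poly_iff)
    then have "r \<notin> P \<or> r \<notin> Q"
      using PQ by blast
    then show ?thesis
      using r(2) id(1,4) by (metis insertI1 insertI2)
  qed
  \<comment> \<open>A nonzero element of the other prime \<open>J\<close> kills all of
    \<open>I\<close>, since the products lie in both primes.\<close>
  have same: "x + y \<in> zero_divisors"
    if I: "\<And>k. Poly_Mapping.lookup x k \<in> I" "\<And>k. Poly_Mapping.lookup y k \<in> I"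
      and IJ: "I \<in> {P, Q}" "J \<in> {P, Q}" "I \<inter> J \<subseteq> {0}" for I J
  proof (cases "J \<subseteq> {0}")
    \<comment> \<open>No such element exists, but then \<open>{0}\<close> is prime, so a coefficient
      of \<open>x\<close> killed by a nonzero \<open>r\<close> is itself 0.\<close>
    case True
    have "Poly_Mapping.lookup x k = 0" for k
    proof -
      obtain r where r: "r \<noteq> 0" "r * Poly_Mapping.lookup x k = 0"
        using x by (auto simp: zero_divisors_mv_poly_iff)
      then show ?thesis
        using id(4)[OF IJ(2), of r "Poly_Mapping.lookup x k"] id(1)[OF IJ(2)] True by auto
    qed
    then have "x = 0"
      by (auto intro: poly_mapping_eqI)
    then show ?thesis
      using y by simp
  next
    case False
    then obtain q where q: "q \<in> J" "q \<noteq> 0"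
      by blast
    have "q * Poly_Mapping.lookup (x + y) k \<in> I \<inter> J" for k
      using id(3)[OF IJ(2) q(1), of "Poly_Mapping.lookup (x + y) k"]
        id(3)[OF IJ(1) id(2)[OF IJ(1) I(1)[of k] I(2)[of k]], of q]
      by (simp add: lookup_add mult.commute)
    then show ?thesis
      using IJ(3) q(2) by (auto simp: zero_divisors_mv_poly_iff)
  qed
  \<comment> \<open>A product of a coefficient in \<open>P\<close> and one in \<open>Q\<close> lies
    in both primes.\<close>
  have mixed: "u * v = 0"
    if "\<And>k. Poly_Mapping.lookup u k \<in> P" "\<And>k. Poly_Mapping.lookup v k \<in> Q"
    for u v :: "('a, 'v) mv_poly"
  proof -
    have "Poly_Mapping.lookup u k * Poly_Mapping.lookup v l = 0" for k l
      using id(3)[of P "Poly_Mapping.lookup u k" "Poly_Mapping.lookup v l"]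
        id(3)[of Q "Poly_Mapping.lookup v l" "Poly_Mapping.lookup u k"] that PQ
      by (auto simp: mult.commute)
    then have "(\<Sum>k\<in>Poly_Mapping.keys u. Poly_Mapping.single k (Poly_Mapping.lookup u k)) *
     (\<Sum>l\<in>Poly_Mapping.keys v. Poly_Mapping.single l (Poly_Mapping.lookup v l)) = 0"
      by (simp add: sum_product mult_single)
    then show ?thesis
      by (simp flip: poly_mapping_eq_sum_single)
  qed
  show ?thesis
    using side[OF x] side[OF y] same[of P Q] same[of Q P] mixed[of x y] mixed[of y x] PQ
    by (auto simp: mult.commute Int_commute)
qed

text \<open>For \<open>a f \<noteq> 0\<close> and \<open>b f \<noteq> 0\<close> the vertices \<open>a f + g\<close> and \<open>X f\<close> violate completeness, where
  \<open>X\<close> is a monomial that moves the terms of \<open>f\<close> away from those of \<open>a f + g\<close>.\<close>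

lemma primeideal_annihilator_if_complete:
  fixes f g :: "('a::comm_ring_1, 'v::finite) mv_poly"
  assumes complete: "\<And>x y :: ('a, 'v) mv_poly. x \<in> zero_divisors \<Longrightarrow> y \<in> zero_divisors \<Longrightarrow>
      x * y = 0 \<or> x + y \<in> zero_divisors"
    and f: "f \<in> zero_divisors" and g: "g \<in> zero_divisors" and fg: "f + g \<notin> zero_divisors"
  shows "primeideal {r. Poly_Mapping.single 0 r * f = 0} ring_of_type_algebra"
proof -
  have fg0: "f * g = 0"
    using complete f g fg by blast
  have regular: "h = 0" if "(f + g) * h = 0" for h
    using fg that by (auto simp: zero_divisors_def)
  \<comment> \<open>Because \<open>f * g = 0\<close>, multiplying \<open>h * f\<close> by the
    regular \<open>f + g\<close> has the same effect as multiplying it by \<open>f\<close>.\<close>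
  have sq: "h * f = 0" if "h * f * f = 0" for h
  proof (rule regular)
    have "(f + g) * (h * f) = h * f * f + h * (f * g)"
      by (simp only: algebra_simps)
    then show "(f + g) * (h * f) = 0"
      by (simp add: that fg0)
  qed
  have g0: "g \<noteq> 0" and f0: "f \<noteq> 0"
    using f g fg by auto
  \<comment> \<open>Shown for polynomials \<open>a\<close> and \<open>b\<close>, and specialized to
    constants at the end.\<close>
  have prime: "a * f = 0 \<or> b * f = 0" if ab: "a * b * f = 0" for a b
  proof (rule ccontr)
    assume "\<not> (a * f = 0 \<or> b * f = 0)"
    then have af: "a * f \<noteq> 0" and bf: "b * f \<noteq> 0"
      by auto
    define x where "x = a * f + g"
    have "x * (b * f) = (a * b * f) * f + b * (f * g)"
      by (simp only: x_def algebra_simps)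
    then have x: "x \<in> zero_divisors"
      using ab fg0 bf by (auto simp: zero_divisors_def)
    \<comment> \<open>Subtraction of exponents truncates, but \<open>(e + k) - k = e\<close> holds,
      so avoiding these differences keeps \<open>e + k\<close> out of the keys of
      \<open>x\<close>.\<close>
    let ?E = "\<Union>k\<in>Poly_Mapping.keys f. (\<lambda>l. l - k) ` Poly_Mapping.keys x"
    obtain e where "e \<notin> ?E"
      using ex_new_if_finite[OF infinite_exponents, of ?E] by auto
    then have e: "e + k \<notin> Poly_Mapping.keys x" if "k \<in> Poly_Mapping.keys f" for k
      using that by (metis (no_types, lifting) UN_I add_diff_cancel_right' imageI)
    define y where "y = Poly_Mapping.single e 1 * f"
    have "y * g = 0"
      by (simp add: y_def mult.assoc fg0)
    then have y: "y \<in> zero_divisors"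
      using g0 by (auto simp: zero_divisors_def)
    have "x * y = Poly_Mapping.single e 1 * (a * f * f) + Poly_Mapping.single e 1 * (f * g)"
      by (simp only: x_def y_def algebra_simps)
    then have xy: "x * y = Poly_Mapping.single e 1 * (a * f * f)"
      by (simp add: fg0)
    \<comment> \<open>The shift by \<open>e\<close> loses no coefficient, so a zero product would
      give \<open>a * f * f = 0\<close> and hence \<open>a * f = 0\<close>.\<close>
    have "x * y \<noteq> 0"
    proof
      assume "x * y = 0"
      then have "Poly_Mapping.lookup (a * f * f) k = 0" for k
        using lookup_single_mult[of e 1 "a * f * f" k] by (simp add: xy)
      then have "a * f * f = 0"
        by (auto intro: poly_mapping_eqI)
      with sq af show False
        by blast
    qed
    then have "x + y \<in> zero_divisors"
      using complete x y by blast
    then obtain r where r: "r \<noteq> 0" "\<And>k. r * Poly_Mapping.lookup (x + y) k = 0"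
      by (auto simp: zero_divisors_mv_poly_iff)
    let ?r = "Poly_Mapping.single 0 r :: ('a, 'v) mv_poly"
    have const: "Poly_Mapping.lookup (?r * p) k = r * Poly_Mapping.lookup p k" for p k
      using lookup_single_mult[of 0 r p k] by simp
    \<comment> \<open>At the shifted exponents the coefficients of \<open>x + y\<close> are those of
      \<open>f\<close> alone, so \<open>r\<close> kills \<open>f\<close>.\<close>
    have "r * Poly_Mapping.lookup f k = 0" for k
    proof (cases "k \<in> Poly_Mapping.keys f")
      case True
      then have "Poly_Mapping.lookup (x + y) (e + k) = Poly_Mapping.lookup f k"
        using e[OF True] lookup_single_mult[of e 1 f k] by (simp add: lookup_add y_def in_keys_iff)
      then show ?thesis
        using r(2)[of "e + k"] by simp
    qed (simp add: in_keys_iff)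
    then have rf: "?r * f = 0"
      by (intro poly_mapping_eqI) (simp add: const)
    have "?r * (x + y) = 0"
      by (intro poly_mapping_eqI) (simp add: const r)
    \<comment> \<open>As \<open>?r * f = 0\<close>, only \<open>?r * g\<close> remains, so it is 0
      too and \<open>?r\<close> kills the regular \<open>f + g\<close>.\<close>
    moreover have "?r * (x + y) = a * (?r * f) + ?r * g + Poly_Mapping.single e 1 * (?r * f)"
      by (simp only: x_def y_def algebra_simps)
    ultimately have "(f + g) * ?r = 0"
      using rf by (simp add: distrib_right mult.commute)
    then have "?r = 0"
      by (rule regular)
    then show False
      using r(1) by (metis lookup_single_eq lookup_zero)
  qed
  have "ideal {r. Poly_Mapping.single 0 r * f = 0} ring_of_type_algebra"
    unfolding ideal_ring_of_type_algebra_iff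
  proof (intro conjI ballI allI)
    fix s r
    assume "s \<in> {r. Poly_Mapping.single 0 r * f = 0}"
    then have "Poly_Mapping.single 0 r * (Poly_Mapping.single 0 s * f) = 0"
      by simp
    then show "r * s \<in> {r. Poly_Mapping.single 0 r * f = 0}"
      by (simp add: mult_single flip: mult.assoc)
  qed (auto simp: single_add distrib_right)
  moreover have "Poly_Mapping.single 0 a * f = 0 \<or> Poly_Mapping.single 0 b * f = 0"
    if "Poly_Mapping.single 0 (a * b) * f = 0" for a b
    using that by (intro prime) (simp add: mult_single)
  ultimately show ?thesis
    using f0 by (simp add: primeideal_ring_of_type_algebra_iff)
qed

text \<open>A constant that kills both \<open>f\<close> and \<open>g\<close> kills the regular
  \<open>f + g\<close>. The hypotheses are symmetric in \<open>f\<close> and \<open>g\<close>, so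
  both annihilators are prime by the same lemma.\<close>

lemma subring_of_domain_product_if_complete:
  fixes f g :: "('a::comm_ring_1, 'v::finite) mv_poly"
  assumes complete: "\<And>x y :: ('a, 'v) mv_poly. x \<in> zero_divisors \<Longrightarrow> y \<in> zero_divisors \<Longrightarrow>
      x * y = 0 \<or> x + y \<in> zero_divisors"
    and f: "f \<in> zero_divisors" and g: "g \<in> zero_divisors" and fg: "f + g \<notin> zero_divisors"
  shows "subring_of_domain_product (ring_of_type_algebra :: 'a ring)"
proof -
  have "r = 0" if "Poly_Mapping.single 0 r * f = 0" "Poly_Mapping.single 0 r * g = 0" for r
  proof -
    have "(f + g) * Poly_Mapping.single 0 r = 0"
      using that by (simp add: distrib_right mult.commute)
    then have "Poly_Mapping.single 0 r = (0 :: ('a, 'v) mv_poly)"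
      using fg by (auto simp: zero_divisors_def)
    then show ?thesis
      by (metis lookup_single_eq lookup_zero)
  qed
  then have "{r. Poly_Mapping.single 0 r * f = 0} \<inter> {r. Poly_Mapping.single 0 r * g = 0} \<subseteq> {0}"
    by auto
  moreover have "primeideal {r. Poly_Mapping.single 0 r * f = 0} ring_of_type_algebra"
    using primeideal_annihilator_if_complete[OF complete f g fg] .
  moreover have "primeideal {r. Poly_Mapping.single 0 r * g = 0} ring_of_type_algebra"
    using primeideal_annihilator_if_complete[OF complete g f] fg by (simp add: add.commute)
  ultimately show ?thesis
    unfolding subring_of_domain_product_iff by blast
qed

theorem theorem1p12:
  shows
    "(complete_sgraph (zd_graph :: ('a::comm_ring_1, 'v::finite) mv_poly sgraph) \<longleftrightarrow>
        subring_of_domain_product (ring_of_type_algebra :: 'a ring) \<or>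
        (ideal (zero_divisors :: 'a poly set) ring_of_type_algebra \<or>
         (property_A TYPE('a) \<and> ideal (zero_divisors :: 'a set) ring_of_type_algebra) \<or>
         (\<forall>S :: 'a set. finite S \<and> S \<subseteq> zero_divisors \<longrightarrow>
            annihilator (Idl\<^bsub>ring_of_type_algebra\<^esub> S) \<noteq> {0})))
     \<and> (ideal (zero_divisors :: 'a poly set) ring_of_type_algebra \<longleftrightarrow>
          property_A TYPE('a) \<and> ideal (zero_divisors :: 'a set) ring_of_type_algebra)
     \<and> (property_A TYPE('a) \<and> ideal (zero_divisors :: 'a set) ring_of_type_algebra \<longleftrightarrow>
          (\<forall>S :: 'a set. finite S \<and> S \<subseteq> zero_divisors \<longrightarrow>
             annihilator (Idl\<^bsub>ring_of_type_algebra\<^esub> S) \<noteq> {0}))"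
proof -
  \<comment> \<open>Statement (c), with the generators in place of the ideal they generate.\<close>
  let ?c = "\<forall>S :: 'a set. finite S \<and> S \<subseteq> zero_divisors \<longrightarrow> annihilator S \<noteq> {0}"
  have "complete_sgraph (zd_graph :: ('a, 'v) mv_poly sgraph) \<longleftrightarrow>
    subring_of_domain_product (ring_of_type_algebra :: 'a ring) \<or> ?c"
  proof
    assume "complete_sgraph (zd_graph :: ('a, 'v) mv_poly sgraph)"
    \<comment> \<open>Either zero-divisors are closed under sums, or two of them with a regular sum
      give the primes.\<close>
    then have "subring_of_domain_product (ring_of_type_algebra :: 'a ring) \<or>
      ideal (zero_divisors :: ('a, 'v) mv_poly set) ring_of_type_algebra"
      unfolding complete_zd_graph_iff ideal_zero_divisors_iff using subring_of_domain_product_if_complete by blast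
    then show "subring_of_domain_product (ring_of_type_algebra :: 'a ring) \<or> ?c"
      unfolding mv_poly.ideal_zero_divisors_iff_annihilator .
  next
    assume "subring_of_domain_product (ring_of_type_algebra :: 'a ring) \<or> ?c"
    then show "complete_sgraph (zd_graph :: ('a, 'v) mv_poly sgraph)"
      \<comment> \<open>Statement (c) does not mention the variables, so they are fixed here when
        (c) is turned back into a statement on polynomials.\<close>
      unfolding mv_poly.ideal_zero_divisors_iff_annihilator[symmetric, where 'v = 'v]
        complete_zd_graph_iff ideal_zero_divisors_iff subring_of_domain_product_iff
      using zero_divisors_mv_poly_of_primes by blast
  qed
  then show ?thesis
    \<comment> \<open>All of (a), (b) and (c) become \<open>?c\<close>.\<close>
    unfolding annihilator_genideal poly.ideal_zero_divisors_iff_annihilator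
      property_A_and_ideal_zero_divisors_iff by blast
qed

end
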